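(* In the setting of the inexact two-level method described in the context, suppose that $$\big\|A_{\rm c}^{-1}\mathbf{r}_{k-1}-\mathscr{B}_{\rm c}^{(k)}(\mathbf{r}_{k-1})\big\|_{A_{\rm c}}\leq\varepsilon_{k}\|\mathbf{r}_{k-1}\|_{A_{\rm c}^{-1}}$$ for some $\varepsilon_{k}\in[0,1)$ and all $k=1,2,\ldots,\nu$, and set $\varepsilon=\prod_{k=1}^{\nu}\varepsilon_{k}$. Then the output $\mathbf{u}_{\rm ITL}$ of the inexact two-level method satisfies $$\|\mathbf{u}-\mathbf{u}_{\rm ITL}\|_{A}\leq\sigma_{\rm ITL}\big\|\mathbf{u}-\mathbf{u}^{(0)}\big\|_{A},$$ where $$\sigma_{\rm ITL}=\begin{cases}1-\frac{1}{K_{\rm TL}}+\varepsilon(1-\mu_{\rm TL}) & \text{if } \operatorname{rank}(S^{T}AP)=n_{\rm c},\\ 1-\frac{1}{K_{\rm TL}}+\varepsilon & \text{if } \operatorname{rank}(S^{T}AP)<n_{\rm c}.\end{cases}$$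
   Context: Setting. $A\in\mathbb{R}^{n\times n}$ is symmetric positive definite (SPD), $\mathbf{f}\in\mathbb{R}^{n}$, and $\mathbf{u}=A^{-1}\mathbf{f}$. $S\in\mathbb{R}^{n\times n_{\rm s}}$ and $P\in\mathbb{R}^{n\times n_{\rm c}}$ have full column rank, the block matrix $(S\ \ P)$ has rank $n$, and $\max\{n_{\rm s},n_{\rm c}\}<n\leq n_{\rm s}+n_{\rm c}$. Put $A_{\rm s}=S^{T}AS$ and $A_{\rm c}=P^{T}AP$. $M_{\rm s}\in\mathbb{R}^{n_{\rm s}\times n_{\rm s}}$ is nonsingular (not necessarily symmetric) and $M_{\rm s}+M_{\rm s}^{T}-A_{\rm s}$ is SPD. $\nu\geq1$ is an integer, and for $k=1,\ldots,\nu$, $\mathscr{B}_{\rm c}^{(k)}:\mathbb{R}^{n_{\rm c}}\to\mathbb{R}^{n_{\rm c}}$ is a general (possibly nonlinear) mapping. Inexact two-level method. Given an initial guess $\mathbf{u}^{(0)}\in\mathbb{R}^{n}$: (1) $\mathbf{u}^{(1)}=\mathbf{u}^{(0)}+SM_{\rm s}^{-1}S^{T}(\mathbf{f}-A\mathbf{u}^{(0)})$ (presmoothing); (2) $\mathbf{r}_{\rm c}=P^{T}(\mathbf{f}-A\mathbf{u}^{(1)})$; (3) $\mathbf{e}_{\rm c}^{(0)}=\mathbf{0}$ and $\mathbf{e}_{\rm c}^{(k)}=\mathbf{e}_{\rm c}^{(k-1)}+\mathscr{B}_{\rm c}^{(k)}(\mathbf{r}_{\rm c}-A_{\rm c}\mathbf{e}_{\rm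 c}^{(k-1)})$ for $k=1,\ldots,\nu$; (4) $\mathbf{u}^{(2)}=\mathbf{u}^{(1)}+P\mathbf{e}_{\rm c}^{(\nu)}$; (5) $\mathbf{u}_{\rm ITL}=\mathbf{u}^{(2)}+SM_{\rm s}^{-T}S^{T}(\mathbf{f}-A\mathbf{u}^{(2)})$ (postsmoothing). Coarse residuals. Let $\Phi_{\rm c}^{(k)}(\mathbf{x})=\mathbf{x}-A_{\rm c}\mathscr{B}_{\rm c}^{(k)}(\mathbf{x})$. Define $\mathbf{r}_{0}=\mathbf{r}_{\rm c}$ and $\mathbf{r}_{k}=(\Phi_{\rm c}^{(k)}\circ\cdots\circ\Phi_{\rm c}^{(1)})(\mathbf{r}_{\rm c})$ for $k=1,\ldots,\nu$. Norms. For an SPD matrix $G$, $\|\mathbf{v}\|_{G}=\sqrt{\mathbf{v}^{T}G\mathbf{v}}$. Quantities. $\varPi_{A}=PA_{\rm c}^{-1}P^{T}A$ and $\widetilde{M}_{\rm s}=M_{\rm s}^{T}(M_{\rm s}+M_{\rm s}^{T}-A_{\rm s})^{-1}M_{\rm s}$. Further, $$K_{\rm TL}=\sup_{\mathbf{v}\in\operatorname{range}(I-\varPi_{A})\setminus\{\mathbf{0}\}}\ \inf_{\mathbf{v}_{\rm s}\in\mathbb{R}^{n_{\rm s}}:\ \mathbf{v}=(I-\varPi_{A})S\mathbf{v}_{\rm s}}\frac{\mathbf{v}_{\rm s}^{T}\widetilde{M}_{\rm s}\mathbf{v}_{\rm s}}{\mathbf{v}^{T}A\mathbf{v}},$$ and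 $\mu_{\rm TL}=\lambda_{\min}^{+}(S\widetilde{M}_{\rm s}^{-1}S^{T}A\varPi_{A})$, where $\lambda_{\min}^{+}(\cdot)$ denotes the smallest positive eigenvalue ($\mu_{\rm TL}$ is only used when $\operatorname{rank}(S^{T}AP)=n_{\rm c}$). *)

theory Defs
  imports "HOL-Analysis.Analysis"
begin

definition spd :: "real^'n^'n \<Rightarrow> bool" where
  "spd G \<longleftrightarrow> transpose G = G \<and> (\<forall>v. v \<noteq> 0 \<longrightarrow> v \<bullet> (G *v v) > 0)"

definition mnorm :: "real^'n^'n \<Rightarrow> real^'n \<Rightarrow> real" where
  "mnorm G v = sqrt (v \<bullet> (G *v v))"

definition eigenvalue :: "real^'n^'n \<Rightarrow> real \<Rightarrow> bool" where
  "eigenvalue X l \<longleftrightarrow> (\<exists>v. v \<noteq> 0 \<and> X *v v = l *\<^sub>R v)"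

text \<open>A matrix has only finitely many eigenvalues, so the minimum is attained as soon as there is
  a positive eigenvalue; if there is none, the value is unspecified.\<close>

definition lambda_min_pos :: "real^'n^'n \<Rightarrow> real" where
  "lambda_min_pos X = Min {l. 0 < l \<and> eigenvalue X l}"

text \<open>The block matrix \<open>(S P)\<close>: its columns are indexed by the disjoint sum of the two column
  index types.\<close>

definition hblock :: "real^'s^'n \<Rightarrow> real^'c^'n \<Rightarrow> real^('s + 'c)^'n" where
  "hblock S P = (\<chi> i j. case j of Inl a \<Rightarrow> S $ i $ a | Inr b \<Rightarrow> P $ i $ b)"

text \<open>Used both for \<open>A\<^sub>s\<close> (with \<open>S\<close>) and for \<open>A\<^sub>c\<close> (with \<open>P\<close>).\<close>

definition galerkin :: "real^'n^'n \<Rightarrow> real^'m^'n \<Rightarrow> real^'m^'m" where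
  "galerkin A Q = transpose Q ** A ** Q"

definition presmooth ::
  "real^'n^'n \<Rightarrow> real^'n \<Rightarrow> real^'s^'n \<Rightarrow> real^'s^'s \<Rightarrow> real^'n \<Rightarrow> real^'n" where
  "presmooth A f S Ms u0 = u0 + S *v (matrix_inv Ms *v (transpose S *v (f - A *v u0)))"

definition coarse_rhs ::
  "real^'n^'n \<Rightarrow> real^'n \<Rightarrow> real^'s^'n \<Rightarrow> real^'c^'n \<Rightarrow> real^'s^'s \<Rightarrow> real^'n \<Rightarrow> real^'c" where
  "coarse_rhs A f S P Ms u0 = transpose P *v (f - A *v presmooth A f S Ms u0)"

text \<open>Only the mappings \<open>B 1, \<dots>, B \<nu>\<close> matter; \<open>B 0\<close> is never used.\<close>

primrec coarse_iter ::
  "real^'c^'c \<Rightarrow> (nat \<Rightarrow> real^'c \<Rightarrow> real^'c) \<Rightarrow> real^'c \<Rightarrow> nat \<Rightarrow> real^'c" where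
  "coarse_iter Ac B rc 0 = 0"
| "coarse_iter Ac B rc (Suc k) =
     coarse_iter Ac B rc k + B (Suc k) (rc - Ac *v coarse_iter Ac B rc k)"

definition u_ITL ::
  "real^'n^'n \<Rightarrow> real^'n \<Rightarrow> real^'s^'n \<Rightarrow> real^'c^'n \<Rightarrow> real^'s^'s \<Rightarrow>
     (nat \<Rightarrow> real^'c \<Rightarrow> real^'c) \<Rightarrow> nat \<Rightarrow> real^'n \<Rightarrow> real^'n" where
  "u_ITL A f S P Ms B \<nu> u0 =
     (let u1 = presmooth A f S Ms u0;
          rc = coarse_rhs A f S P Ms u0;
          ec = coarse_iter (galerkin A P) B rc \<nu>;
          u2 = u1 + P *v ec
      in u2 + S *v (matrix_inv (transpose Ms) *v (transpose S *v (f - A *v u2))))"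

definition Phi ::
  "real^'c^'c \<Rightarrow> (nat \<Rightarrow> real^'c \<Rightarrow> real^'c) \<Rightarrow> nat \<Rightarrow> real^'c \<Rightarrow> real^'c" where
  "Phi Ac B k x = x - Ac *v B k x"

primrec Phi_comp ::
  "real^'c^'c \<Rightarrow> (nat \<Rightarrow> real^'c \<Rightarrow> real^'c) \<Rightarrow> nat \<Rightarrow> real^'c \<Rightarrow> real^'c" where
  "Phi_comp Ac B 0 = id"
| "Phi_comp Ac B (Suc k) = Phi Ac B (Suc k) \<circ> Phi_comp Ac B k"

definition coarse_residual ::
  "real^'n^'n \<Rightarrow> real^'n \<Rightarrow> real^'s^'n \<Rightarrow> real^'c^'n \<Rightarrow> real^'s^'s \<Rightarrow>
     (nat \<Rightarrow> real^'c \<Rightarrow> real^'c) \<Rightarrow> real^'n \<Rightarrow> nat \<Rightarrow> real^'c" where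
  "coarse_residual A f S P Ms B u0 k =
     Phi_comp (galerkin A P) B k (coarse_rhs A f S P Ms u0)"

definition Pi_A :: "real^'n^'n \<Rightarrow> real^'c^'n \<Rightarrow> real^'n^'n" where
  "Pi_A A P = P ** matrix_inv (galerkin A P) ** transpose P ** A"

definition Mtilde :: "real^'n^'n \<Rightarrow> real^'s^'n \<Rightarrow> real^'s^'s \<Rightarrow> real^'s^'s" where
  "Mtilde A S Ms =
     transpose Ms ** matrix_inv (Ms + transpose Ms - galerkin A S) ** Ms"

text \<open>Under the standing assumptions the outer index set is nonempty since \<open>n\<^sub>c < n\<close>, every inner
  index set is nonempty since \<open>(S P)\<close> has rank \<open>n\<close>, and the quotients are bounded below by \<open>0\<close>;
  the infima are bounded above in \<open>v\<close>. So the real-valued supremum and infima below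
  are genuine ones.\<close>

definition K_TL ::
  "real^'n^'n \<Rightarrow> real^'s^'n \<Rightarrow> real^'c^'n \<Rightarrow> real^'s^'s \<Rightarrow> real" where
  "K_TL A S P Ms =
     (SUP v \<in> range (\<lambda>x. (mat 1 - Pi_A A P) *v x) - {0}.
        INF vs \<in> {vs. v = (mat 1 - Pi_A A P) *v (S *v vs)}.
          (vs \<bullet> (Mtilde A S Ms *v vs)) / (v \<bullet> (A *v v)))"

definition mu_TL ::
  "real^'n^'n \<Rightarrow> real^'s^'n \<Rightarrow> real^'c^'n \<Rightarrow> real^'s^'s \<Rightarrow> real" where
  "mu_TL A S P Ms =
     lambda_min_pos (S ** matrix_inv (Mtilde A S Ms) ** transpose S ** A ** Pi_A A P)"

text \<open>The rank of \<open>S\<^sup>T A P\<close> never exceeds its number \<open>n\<^sub>c\<close> of columns, so the second branch is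
  exactly the rank-deficient case.\<close>

definition sigma_ITL ::
  "real^'n^'n \<Rightarrow> real^'s^'n \<Rightarrow> real^'c^'n \<Rightarrow> real^'s^'s \<Rightarrow> real \<Rightarrow> real" where
  "sigma_ITL A S P (Ms :: real^'s^'s) \<epsilon> =
     (if rank (transpose S ** A ** P) = CARD('c)
      then 1 - 1 / K_TL A S P Ms + \<epsilon> * (1 - mu_TL A S P Ms)
      else 1 - 1 / K_TL A S P Ms + \<epsilon>)"

end

theory Submission
  imports Defs
begin

text \<open>
  Work in the energy inner product \<open>(x, y) \<mapsto> x\<^sup>T A y\<close>. With \<open>T = I - S Ms\<^sup>-\<^sup>1 S\<^sup>T A\<close> the error operator of
  presmoothing, postsmoothing has the adjoint \<open>T\<^sup>*\<close> as its error operator, and \<open>\<Pi>\<^sub>A\<close> is the orthogonal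
  projection onto the range of \<open>P\<close>. An exact coarse solve would leave the error \<open>(I - \<Pi>\<^sub>A) T e\<close>; the
  inexact one adds some \<open>P y\<close> to it, and since each coarse step multiplies the energy norm of the
  coarse error by at most \<open>\<epsilon>\<^sub>k\<close>, the norm of \<open>P y\<close> is at most \<open>\<epsilon>\<close> times that of \<open>\<Pi>\<^sub>A T e\<close>
  (\<open>coarse_error_decay\<close>). The final error is therefore \<open>w = T\<^sup>* ((I - \<Pi>\<^sub>A) T e + P y)\<close>. Pair it with itself,
  move \<open>T\<^sup>*\<close> to the other side, and split orthogonally: the Cauchy-Schwarz inequality gives
  \<open>\<parallel>w\<parallel>\<^sup>2 \<le> \<parallel>(I - \<Pi>\<^sub>A) T w\<parallel> \<parallel>(I - \<Pi>\<^sub>A) T e\<parallel> + \<epsilon> \<parallel>\<Pi>\<^sub>A T w\<parallel> \<parallel>\<Pi>\<^sub>A T e\<parallel>\<close>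
  (\<open>inexact_cycle_bound\<close>).

  It remains to bound the operator norms of \<open>(I - \<Pi>\<^sub>A) T\<close> and \<open>\<Pi>\<^sub>A T\<close>. They equal the norms of the adjoints,
  that is, of \<open>T\<^sup>*\<close> restricted to the two ranges. There \<open>post_energy\<close> says that \<open>T\<^sup>*\<close> lowers the squared
  energy of \<open>z\<close> by exactly \<open>damping z = (S\<^sup>T A z)\<^sup>T M\<^sup>-\<^sup>1 (S\<^sup>T A z)\<close>, where \<open>M\<close> is the symmetrized smoother. On the
  range of \<open>I - \<Pi>\<^sub>A\<close> a duality argument bounds \<open>damping z\<close> below by \<open>1 / K\<^sub>T\<^sub>L\<close> times the squared energy
  (\<open>K_TL_bound\<close>); on the range of \<open>P\<close> the corresponding factor is an eigenvalue, at least \<open>\<mu>\<^sub>T\<^sub>L\<close>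
  (\<open>mu_TL_bound\<close>), or trivially \<open>0\<close> if \<open>S\<^sup>T A P\<close> is rank deficient. So the squares of the two operator norms
  are at most \<open>1 - 1 / K\<^sub>T\<^sub>L\<close> and \<open>1 - \<mu>\<^sub>T\<^sub>L\<close> (or \<open>1\<close>); with weight \<open>\<epsilon>\<close> on
  the second, they add up to the claimed factor.
\<close>

section \<open>Symmetric positive definite matrices\<close>

text \<open>Transposes are moved across the inner product below, so the simplifier must not turn
  them into vector-matrix products.\<close>
declare transpose_matrix_vector [simp del]

lemma inner_transpose_left: "(transpose M *v x) \<bullet> y = x \<bullet> (M *v y)"
  for M :: "real^'m^'n"
  by (simp add: transpose_matrix_vector dot_lmul_matrix)

lemma inner_transpose_right: "x \<bullet> (transpose M *v y) = (M *v x) \<bullet> y"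
  for M :: "real^'m^'n"
  by (metis inner_commute inner_transpose_left)

lemma matrix_inv_cancel:
  fixes M :: "real^'n^'n"
  assumes "invertible M"
  shows "matrix_inv M *v (M *v x) = x" and "M *v (matrix_inv M *v x) = x"
proof -
  have "M ** matrix_inv M = mat 1 \<and> matrix_inv M ** M = mat 1"
    using assms unfolding invertible_def matrix_inv_def by (rule someI_ex)
  then show "matrix_inv M *v (M *v x) = x" and "M *v (matrix_inv M *v x) = x"
    by (auto simp: matrix_vector_mul_assoc)
qed

lemma spd_sym: "spd G \<Longrightarrow> x \<bullet> (G *v y) = y \<bullet> (G *v x)"
  using inner_transpose_left[of G x y] by (simp add: spd_def inner_commute)

lemma spd_pos: "spd G \<Longrightarrow> x \<noteq> 0 \<Longrightarrow> 0 < x \<bullet> (G *v x)"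
  by (simp add: spd_def)

lemma spd_nonneg: "spd G \<Longrightarrow> 0 \<le> x \<bullet> (G *v x)"
  by (cases "x = 0") (auto simp: spd_def less_imp_le)

lemma mnorm_nonneg: "spd G \<Longrightarrow> 0 \<le> mnorm G x"
  by (simp add: mnorm_def spd_nonneg)

lemma mnorm_sq: "spd G \<Longrightarrow> (mnorm G x)\<^sup>2 = x \<bullet> (G *v x)"
  by (simp add: mnorm_def spd_nonneg)

lemma mnorm_eq_0: "spd G \<Longrightarrow> mnorm G x = 0 \<longleftrightarrow> x = 0"
  using spd_pos[of G x] by (cases "x = 0") (auto simp: mnorm_def)

lemma spd_invertible:
  fixes G :: "real^'n^'n"
  assumes "spd G"
  shows "invertible G"
proof -
  have "\<forall>x. G *v x = 0 \<longrightarrow> x = 0"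
    using spd_pos[OF assms] by (metis inner_zero_right less_irrefl)
  then show ?thesis
    by (simp add: invertible_left_inverse matrix_left_invertible_ker)
qed

lemma spd_congruence:
  fixes G :: "real^'n^'n" and C :: "real^'m^'n"
  assumes "spd G" and "inj ((*v) C)"
  shows "spd (transpose C ** G ** C)"
proof -
  have "transpose (transpose C ** G ** C) = transpose C ** G ** C"
    using assms(1) by (simp add: spd_def matrix_transpose_mul matrix_mul_assoc)
  moreover have "v \<bullet> ((transpose C ** G ** C) *v v) = (C *v v) \<bullet> (G *v (C *v v))" for v
    by (simp add: matrix_vector_mul_assoc[symmetric] inner_transpose_right)
  moreover have "C *v v \<noteq> 0" if "v \<noteq> 0" for v
    using assms(2) that by (metis injD matrix_vector_mult_0_right)
  ultimately show ?thesis
    using assms(1) by (simp add: spd_def)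
qed

lemma spd_inverse:
  fixes G :: "real^'n^'n"
  assumes "spd G"
  shows "spd (matrix_inv G)"
proof -
  note inv = matrix_inv_cancel[OF spd_invertible[OF assms]]
  have sym: "x \<bullet> (matrix_inv G *v y) = y \<bullet> (matrix_inv G *v x)" for x y
    using spd_sym[OF assms, of "matrix_inv G *v x" "matrix_inv G *v y"]
    by (simp add: inv inner_commute)
  have "transpose (matrix_inv G) *v x = matrix_inv G *v x" for x
    by (rule vector_eq_ldot[THEN iffD1]) (metis inner_commute inner_transpose_right sym)
  then have "transpose (matrix_inv G) = matrix_inv G"
    by (simp add: matrix_eq)
  moreover have "0 < v \<bullet> (matrix_inv G *v v)" if "v \<noteq> 0" for v
  proof -
    have "matrix_inv G *v v \<noteq> 0"
      using inv(2)[of v] that by auto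
    from spd_pos[OF assms this] show ?thesis
      by (simp add: inv inner_commute)
  qed
  ultimately show ?thesis
    by (simp add: spd_def)
qed

text \<open>Only semidefiniteness is assumed because the inequality is also applied to the singular
  matrix \<open>H - l D\<close> at an extremal Rayleigh quotient \<open>l\<close>.\<close>
lemma semidefinite_Cauchy_Schwarz:
  fixes G :: "real^'n^'n"
  assumes sym: "transpose G = G" and nonneg: "\<And>x. 0 \<le> x \<bullet> (G *v x)"
  shows "(x \<bullet> (G *v y))\<^sup>2 \<le> (x \<bullet> (G *v x)) * (y \<bullet> (G *v y))"
proof -
  define a b c where "a = y \<bullet> (G *v y)" and "b = x \<bullet> (G *v y)" and "c = x \<bullet> (G *v x)"
  have b': "y \<bullet> (G *v x) = b"
    unfolding b_def using sym by (metis inner_commute inner_transpose_left)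
  have quad: "0 \<le> c + 2 * t * b + t\<^sup>2 * a" for t
    using nonneg[of "x + t *\<^sub>R y"]
    by (simp add: a_def b_def c_def b'[unfolded b_def] algebra_simps power2_eq_square
        inner_add_left inner_add_right)
  \<comment> \<open>If \<open>a = 0\<close>, the form is affine in \<open>t\<close>, hence constant; otherwise take the minimizing \<open>t\<close>.\<close>
  show ?thesis
  proof (cases "a = 0")
    case True
    have "b = 0"
    proof (rule ccontr)
      assume "b \<noteq> 0"
      then show False
        using quad[of "- (c + 1) / (2 * b)"] True by (simp add: field_simps)
    qed
    then show ?thesis
      using True by (simp add: a_def b_def)
  next
    case False
    with nonneg[of y] have "a > 0"
      by (simp add: a_def)
    then have "b\<^sup>2 \<le> c * a"
      using quad[of "- b / a"] by (simp add: field_simps power2_eq_square)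
    then show ?thesis
      by (simp add: a_def b_def c_def)
  qed
qed

lemma spd_Cauchy_Schwarz:
  assumes "spd G"
  shows "x \<bullet> (G *v y) \<le> mnorm G x * mnorm G y"
proof (rule power2_le_imp_le)
  show "(x \<bullet> (G *v y))\<^sup>2 \<le> (mnorm G x * mnorm G y)\<^sup>2"
    using semidefinite_Cauchy_Schwarz[of G x y] assms spd_nonneg[OF assms]
    by (simp add: power_mult_distrib mnorm_sq spd_def)
qed (simp add: mnorm_nonneg assms)

text \<open>Cauchy-Schwarz in the \<open>G\<close>-inner product for \<open>y\<close> and \<open>G\<^sup>-\<^sup>1 x\<close>.\<close>
lemma spd_dual_Cauchy_Schwarz:
  assumes "spd G"
  shows "(x \<bullet> y)\<^sup>2 \<le> (x \<bullet> (matrix_inv G *v x)) * (y \<bullet> (G *v y))"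
proof -
  note inv = matrix_inv_cancel[OF spd_invertible[OF assms]]
  have "(y \<bullet> (G *v (matrix_inv G *v x)))\<^sup>2
      \<le> (y \<bullet> (G *v y)) * ((matrix_inv G *v x) \<bullet> (G *v (matrix_inv G *v x)))"
    using assms by (intro semidefinite_Cauchy_Schwarz) (auto simp: spd_nonneg spd_def[of G])
  then show ?thesis
    by (simp add: inv inner_commute mult.commute)
qed

section \<open>Eigenvalues\<close>

text \<open>The generalized Rayleigh quotient attains its minimum \<open>l\<close> on the compact unit sphere, say at \<open>y\<close>.
  Then \<open>H - l D\<close> is positive semidefinite and its form vanishes at \<open>y\<close>; by Cauchy-Schwarz it
  annihilates \<open>y\<close>, which is the eigenvector equation.\<close>
lemma smallest_generalized_eigenvalue:
  fixes H D :: "real^'n^'n"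
  assumes H: "transpose H = H" and D: "spd D"
  obtains l y where "y \<noteq> 0" "H *v y = l *\<^sub>R (D *v y)"
    "\<And>x. l * (x \<bullet> (D *v x)) \<le> x \<bullet> (H *v x)"
proof -
  define f where "f x = (x \<bullet> (H *v x)) / (x \<bullet> (D *v x))" for x
  have Dpos: "0 < x \<bullet> (D *v x)" if "x \<noteq> 0" for x
    using spd_pos[OF D that] .
  have "x \<bullet> (D *v x) \<noteq> 0" if "x \<in> sphere 0 1" for x
    using Dpos[of x] that by (cases "x = 0") auto
  then have "continuous_on (sphere 0 1) f"
    unfolding f_def
    by (intro continuous_intros linear_continuous_on matrix_vector_mul_bounded_linear) blast
  moreover have "sphere (0 :: real^'n) 1 \<noteq> {}"
    by simp
  ultimately obtain y where y: "y \<in> sphere 0 1" "\<And>x. x \<in> sphere 0 1 \<Longrightarrow> f y \<le> f x"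
    using continuous_attains_inf[of "sphere (0 :: real^'n) 1" f] by auto
  then have "y \<noteq> 0"
    by auto
  define l where "l = f y"
  have low: "l * (x \<bullet> (D *v x)) \<le> x \<bullet> (H *v x)" for x
  proof (cases "x = 0")
    case False
    have "f x = f ((1 / norm x) *\<^sub>R x)"
      using False by (simp add: f_def matrix_vector_mult_scaleR)
    with y(2)[of "(1 / norm x) *\<^sub>R x"] False have "l \<le> f x"
      by (simp add: l_def)
    then show ?thesis
      using Dpos[OF False] by (simp add: f_def field_simps)
  qed simp
  define G where "G = H - l *\<^sub>R D"
  have G: "G *v x = H *v x - l *\<^sub>R (D *v x)" for x
    by (simp add: G_def matrix_vector_mult_diff_rdistrib scaleR_matrix_vector_assoc)
  have Gsym: "transpose G = G"
    using H D by (simp add: G_def spd_def vec_eq_iff transpose_def)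
  have Gnonneg: "0 \<le> x \<bullet> (G *v x)" for x
    using low[of x] by (simp add: G inner_diff_right)
  have "y \<bullet> (G *v y) = 0"
    using Dpos[OF \<open>y \<noteq> 0\<close>] by (simp add: G inner_diff_right l_def f_def)
  then have "((G *v y) \<bullet> (G *v y))\<^sup>2 \<le> 0"
    using semidefinite_Cauchy_Schwarz[OF Gsym Gnonneg, of "G *v y" y] by simp
  then have "G *v y = 0"
    by simp
  then show ?thesis
    using that[OF \<open>y \<noteq> 0\<close> _ low] by (simp add: G)
qed

text \<open>Apply \<open>X - m\<close> to a linear relation: the eigenvector of \<open>m\<close> drops out and the other coefficients
  are multiplied by \<open>l - m \<noteq> 0\<close>.\<close>
lemma eigenvectors_linearly_independent:
  fixes X :: "real^'n^'n"
  assumes "finite F" and "\<And>l. l \<in> F \<Longrightarrow> v l \<noteq> 0 \<and> X *v v l = l *\<^sub>R v l"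
    and "(\<Sum>l\<in>F. c l *\<^sub>R v l) = 0" and "l \<in> F"
  shows "c l = 0"
  using assms
proof (induction F arbitrary: c l rule: finite_induct)
  case (insert m F)
  have sum0: "(\<Sum>l\<in>F. c l *\<^sub>R v l) + c m *\<^sub>R v m = 0"
    using insert.prems(2) insert.hyps by (simp add: add.commute)
  let ?L = "(\<Sum>l\<in>F. (c l * l) *\<^sub>R v l)" and ?R = "(\<Sum>l\<in>F. (c l * m) *\<^sub>R v l)"
  have "?L + (c m * m) *\<^sub>R v m = X *v ((\<Sum>l\<in>F. c l *\<^sub>R v l) + c m *\<^sub>R v m)"
    using insert.prems(1)
    by (simp add: matrix_vector_right_distrib matrix_vector_mult_scaleR
        linear_sum[OF matrix_vector_mul_linear])
  also have "\<dots> = m *\<^sub>R ((\<Sum>l\<in>F. c l *\<^sub>R v l) + c m *\<^sub>R v m)"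
    by (simp only: sum0 matrix_vector_mult_0_right scaleR_zero_right)
  also have "\<dots> = ?R + (c m * m) *\<^sub>R v m"
    by (simp add: scaleR_sum_right scaleR_right_distrib mult.commute)
  finally have "?L = ?R"
    by (simp only: add_right_cancel)
  then have diff0: "(\<Sum>l\<in>F. (c l * (l - m)) *\<^sub>R v l) = 0"
    by (simp add: right_diff_distrib scaleR_left_diff_distrib sum_subtractf)
  have F0: "c k = 0" if "k \<in> F" for k
  proof -
    have "c k * (k - m) = 0"
      using insert.prems(1) that by (intro insert.IH[OF _ diff0]) auto
    then show ?thesis
      using insert.hyps(2) that by auto
  qed
  with sum0 have "c m *\<^sub>R v m = 0"
    by simp
  then have "c m = 0"
    using insert.prems(1)[of m] by simp
  with F0 insert.prems(3) show ?case
    by auto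
qed simp

text \<open>The minimum in the definition of \<^const>\<open>lambda_min_pos\<close> bounds its elements from below only
  because it ranges over a finite set.\<close>
lemma finite_eigenvalues:
  fixes X :: "real^'n^'n"
  shows "finite {l. eigenvalue X l}"
proof (rule ccontr)
  assume inf: "infinite {l. eigenvalue X l}"
  obtain F where F: "F \<subseteq> {l. eigenvalue X l}" "finite F" "card F = Suc CARD('n)"
    using infinite_arbitrarily_large[OF inf, of "Suc CARD('n)"] by blast
  have "\<forall>l\<in>F. \<exists>w. w \<noteq> 0 \<and> X *v w = l *\<^sub>R w"
    using F(1) by (auto simp: eigenvalue_def)
  then obtain v where "\<forall>l\<in>F. v l \<noteq> 0 \<and> X *v v l = l *\<^sub>R v l"
    by (rule bchoice[THEN exE])
  then have v: "v l \<noteq> 0 \<and> X *v v l = l *\<^sub>R v l" if "l \<in> F" for l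
    using that by (rule bspec)
  have inj: "inj_on v F"
  proof (rule inj_onI)
    fix k l assume kl: "k \<in> F" "l \<in> F" "v k = v l"
    have "k *\<^sub>R v k = X *v v k"
      by (rule conjunct2[OF v[OF kl(1)], symmetric])
    also have "\<dots> = l *\<^sub>R v k"
      unfolding kl(3) by (rule conjunct2[OF v[OF kl(2)]])
    finally show "k = l"
      using conjunct1[OF v[OF kl(1)]] scaleR_cancel_right by blast
  qed
  have "independent (v ` F)"
    unfolding independent_explicit_finite_subsets
  proof (intro allI ballI impI)
    fix B u x
    assume B: "B \<subseteq> v ` F" "finite B" "(\<Sum>b\<in>B. u b *\<^sub>R b) = 0" "x \<in> B"
    define E where "E = {l\<in>F. v l \<in> B}"
    have "B = v ` E"
      using B(1) by (auto simp: E_def)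
    moreover have "inj_on v E"
      using inj by (rule inj_on_subset) (auto simp: E_def)
    ultimately have "(\<Sum>l\<in>E. u (v l) *\<^sub>R v l) = 0"
      using B(3) by (simp add: sum.reindex)
    moreover have "finite E" and "\<And>l. l \<in> E \<Longrightarrow> v l \<noteq> 0 \<and> X *v v l = l *\<^sub>R v l"
      using v F(2) by (simp_all add: E_def)
    ultimately have "u (v l) = 0" if "l \<in> E" for l
      using eigenvectors_linearly_independent[of E v X "\<lambda>l. u (v l)" l] that by blast
    then show "u x = 0"
      using B(4) \<open>B = v ` E\<close> by auto
  qed
  then have "card (v ` F) \<le> CARD('n)"
    using independent_bound[of "v ` F"] by simp
  then show False
    using F(3) card_image[OF inj] by simp
qed

section \<open>The two-level setting\<close>

locale two_level =
  fixes A :: "real^'n^'n" and S :: "real^'s^'n" and P :: "real^'c^'n" and Ms :: "real^'s^'s"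
  assumes A: "spd A"
    and inj_P: "inj ((*v) P)"
    and surj_SP: "surj ((*v) (hblock S P))"
    and coarse_smaller: "CARD('c) < CARD('n)"
    and Ms: "invertible Ms"
    and N: "spd (Ms + transpose Ms - galerkin A S)"
begin

abbreviation "Ac \<equiv> galerkin A P"
abbreviation "Proj \<equiv> Pi_A A P"
abbreviation "M \<equiv> Mtilde A S Ms"

text \<open>The error operators of pre- and postsmoothing: a smoothing step subtracts the correction
  computed from the residual \<open>f - A v = A (u - v)\<close> of an iterate \<open>v\<close>.\<close>
definition pre :: "real^'n \<Rightarrow> real^'n" where
  "pre x = x - S *v (matrix_inv Ms *v (transpose S *v (A *v x)))"

definition post :: "real^'n \<Rightarrow> real^'n" where
  "post x = x - S *v (matrix_inv (transpose Ms) *v (transpose S *v (A *v x)))"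

text \<open>The squared energy that postsmoothing removes from an error, see \<open>post_energy\<close> below.\<close>
definition damping :: "real^'n \<Rightarrow> real" where
  "damping z = (transpose S *v (A *v z)) \<bullet> (matrix_inv M *v (transpose S *v (A *v z)))"

lemma Ac: "spd Ac"
  unfolding galerkin_def by (rule spd_congruence[OF A inj_P])

lemma Ac_mult: "Ac *v y = transpose P *v (A *v (P *v y))"
  by (simp add: galerkin_def matrix_vector_mul_assoc[symmetric])

lemma M: "spd M"
proof -
  have "inj ((*v) Ms)"
    using matrix_inv_cancel(1)[OF Ms] by (metis injI)
  then show ?thesis
    unfolding Mtilde_def by (intro spd_congruence spd_inverse N)
qed

lemma mnorm_prolong: "mnorm A (P *v y) = mnorm Ac y"
  by (simp add: mnorm_def Ac_mult inner_transpose_right)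

subsection \<open>The coarse projection\<close>
lemma Pi_mult: "Proj *v x = P *v (matrix_inv Ac *v (transpose P *v (A *v x)))"
  by (simp add: Pi_A_def matrix_vector_mul_assoc[symmetric])

lemma Pi_prolong: "Proj *v (P *v y) = P *v y"
  using matrix_inv_cancel(1)[OF spd_invertible[OF Ac], of y] by (simp add: Pi_mult Ac_mult)

lemma Pi_idem: "Proj *v (Proj *v x) = Proj *v x"
  by (subst (2 3) Pi_mult) (rule Pi_prolong)

lemma Pi_self_adjoint: "x \<bullet> (A *v (Proj *v y)) = (Proj *v x) \<bullet> (A *v y)"
proof -
  have "x \<bullet> (A *v (Proj *v y))
      = (transpose P *v (A *v x)) \<bullet> (matrix_inv Ac *v (transpose P *v (A *v y)))" for x y
    by (subst spd_sym[OF A]) (simp add: Pi_mult inner_transpose_left inner_commute)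
  then show ?thesis
    by (metis spd_sym[OF spd_inverse[OF Ac]] spd_sym[OF A])
qed

lemma coPi_mult: "(mat 1 - Proj) *v x = x - Proj *v x"
  by (simp add: matrix_vector_mult_diff_rdistrib)

lemma coPi_self_adjoint:
  "x \<bullet> (A *v ((mat 1 - Proj) *v y)) = ((mat 1 - Proj) *v x) \<bullet> (A *v y)"
  by (simp add: coPi_mult matrix_vector_mult_diff_distrib inner_diff_left inner_diff_right
      Pi_self_adjoint)

lemma coPi_idem: "(mat 1 - Proj) *v ((mat 1 - Proj) *v x) = (mat 1 - Proj) *v x"
  by (simp add: coPi_mult matrix_vector_mult_diff_distrib Pi_idem)

lemma hblock_mult: "hblock S P *v x = S *v (\<chi> a. x $ Inl a) + P *v (\<chi> b. x $ Inr b)"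
  by (simp add: vec_eq_iff matrix_vector_mult_def hblock_def UNIV_Plus_UNIV[symmetric]
      sum.Plus del: UNIV_Plus_UNIV)

text \<open>Since \<open>I - \<Pi>\<^sub>A\<close> kills the range of \<open>P\<close> and the columns of \<open>S\<close> and \<open>P\<close> together span the space, the
  columns of \<open>S\<close> suffice to reach its range. Hence the infima in the definition of \<^const>\<open>K_TL\<close> are
  taken over nonempty sets.\<close>
lemma coPi_smoother_onto: "\<exists>vs. (mat 1 - Proj) *v x = (mat 1 - Proj) *v (S *v vs)"
proof -
  obtain y where "x = hblock S P *v y"
    using surj_SP by (metis surjD)
  then have "(mat 1 - Proj) *v x = (mat 1 - Proj) *v (S *v (\<chi> a. y $ Inl a))"
    by (simp add: hblock_mult coPi_mult matrix_vector_right_distrib Pi_prolong)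
  then show ?thesis ..
qed

text \<open>The range of \<open>P\<close> is a proper subspace, so the supremum in the definition of \<^const>\<open>K_TL\<close> is over a
  nonempty set.\<close>
lemma coPi_nonzero: "\<exists>x. (mat 1 - Proj) *v x \<noteq> 0"
proof (rule ccontr)
  assume "\<not> ?thesis"
  then have "x = P *v (matrix_inv Ac *v (transpose P *v (A *v x)))" for x
    by (metis Pi_mult coPi_mult eq_iff_diff_eq_0)
  then have "surj ((*v) P)"
    by (intro surjI[where f = "\<lambda>x. matrix_inv Ac *v (transpose P *v (A *v x))"]) simp
  with inj_P have "CARD('c) = CARD('n)"
    by (metis full_rank_injective full_rank_surjective)
  with coarse_smaller show False
    by simp
qed

subsection \<open>The smoother\<close>
lemma post_adjoint: "w \<bullet> (A *v post z) = pre w \<bullet> (A *v z)"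
proof -
  define d where "d x = transpose S *v (A *v x)" for x
  have "(matrix_inv Ms *v d w) \<bullet> d z
      = (matrix_inv Ms *v d w) \<bullet> (transpose Ms *v (matrix_inv (transpose Ms) *v d z))"
    by (simp add: matrix_inv_cancel transpose_invertible Ms)
  also have "\<dots> = d w \<bullet> (matrix_inv (transpose Ms) *v d z)"
    by (simp add: inner_transpose_right matrix_inv_cancel Ms)
  finally have "(matrix_inv Ms *v d w) \<bullet> d z = d w \<bullet> (matrix_inv (transpose Ms) *v d z)" .
  moreover have "w \<bullet> (A *v (S *v y)) = d w \<bullet> y" and "(S *v y) \<bullet> (A *v w) = y \<bullet> d w" for w y
    using spd_sym[OF A, of w] by (simp_all add: d_def inner_transpose_left inner_transpose_right inner_commute)
  ultimately show ?thesis
    by (simp add: pre_def post_def d_def[symmetric] matrix_vector_mult_diff_distrib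
        inner_diff_left inner_diff_right)
qed

text \<open>This is the identity \<open>T T\<^sup>* = I - S M\<^sup>-\<^sup>1 S\<^sup>T A\<close> read as a quadratic form: with \<open>b = Ms\<^sup>-\<^sup>T S\<^sup>T A z\<close> both the
  energy lost by \<open>z - S b\<close> and \<^term>\<open>damping z\<close> equal \<open>b\<^sup>T (Ms + Ms\<^sup>T - A\<^sub>s) b\<close>.\<close>
lemma post_energy: "(mnorm A (post z))\<^sup>2 = (mnorm A z)\<^sup>2 - damping z"
proof -
  let ?N = "Ms + transpose Ms - galerkin A S"
  define d where "d = transpose S *v (A *v z)"
  define b where "b = matrix_inv (transpose Ms) *v d"
  have d: "transpose Ms *v b = d"
    by (simp add: b_def matrix_inv_cancel transpose_invertible Ms)
  define w where "w = matrix_inv Ms *v (?N *v b)"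
  have "M *v w = d"
    unfolding w_def Mtilde_def
    by (simp add: matrix_vector_mul_assoc[symmetric] matrix_inv_cancel Ms spd_invertible[OF N] d)
  then have "matrix_inv M *v d = w"
    using matrix_inv_cancel(1)[OF spd_invertible[OF M]] by metis
  then have "damping z = d \<bullet> w"
    by (simp add: damping_def d_def)
  also have "\<dots> = b \<bullet> (?N *v b)"
    by (simp add: d[symmetric] inner_transpose_left w_def matrix_inv_cancel Ms)
  also have "\<dots> = 2 * (b \<bullet> d) - (S *v b) \<bullet> (A *v (S *v b))"
  proof -
    have "b \<bullet> (Ms *v b) = b \<bullet> d"
      by (simp add: d[symmetric] inner_transpose_right inner_commute)
    then show ?thesis
      by (simp add: matrix_vector_mult_diff_rdistrib matrix_vector_mult_add_rdistrib
          inner_diff_right inner_add_right d galerkin_def matrix_vector_mul_assoc[symmetric]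
          inner_transpose_right)
  qed
  finally have damp: "damping z = 2 * (b \<bullet> d) - (S *v b) \<bullet> (A *v (S *v b))" .
  have "(S *v b) \<bullet> (A *v z) = b \<bullet> d" and "z \<bullet> (A *v (S *v b)) = b \<bullet> d"
    using spd_sym[OF A, of z "S *v b"] by (simp_all add: d_def inner_transpose_right)
  then show ?thesis
    using damp
    by (simp add: mnorm_sq A post_def d_def[symmetric] b_def[symmetric]
        matrix_vector_mult_diff_distrib inner_diff_left inner_diff_right)
qed

lemma damping_nonneg: "0 \<le> damping z"
  by (simp add: damping_def spd_nonneg[OF spd_inverse[OF M]])

lemma damping_le: "damping z \<le> (mnorm A z)\<^sup>2"
  using post_energy[of z] zero_le_power2[of "mnorm A (post z)"] by linarith

text \<open>An operator and its adjoint have the same norm. The adjoint of \<open>Q T\<close> is \<open>T\<^sup>* Q\<close>, whose norm on the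
  range of \<open>Q\<close> is controlled by \<^const>\<open>damping\<close>.\<close>
lemma projected_pre_bound:
  fixes Q :: "real^'n^'n"
  assumes adj: "\<And>x y. x \<bullet> (A *v (Q *v y)) = (Q *v x) \<bullet> (A *v y)"
    and idem: "\<And>x. Q *v (Q *v x) = Q *v x"
    and damp: "\<And>x. \<delta> * (mnorm A (Q *v x))\<^sup>2 \<le> damping (Q *v x)"
    and "\<delta> \<le> 1"
  shows "mnorm A (Q *v pre w) \<le> sqrt (1 - \<delta>) * mnorm A w"
proof -
  define z where "z = Q *v pre w"
  have Qz: "Q *v z = z"
    by (simp add: z_def idem)
  have "(mnorm A (post z))\<^sup>2 \<le> (1 - \<delta>) * (mnorm A z)\<^sup>2"
    using damp[of z] by (simp add: post_energy Qz algebra_simps)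
  then have "sqrt ((mnorm A (post z))\<^sup>2) \<le> sqrt ((1 - \<delta>) * (mnorm A z)\<^sup>2)"
    by (rule real_sqrt_le_mono)
  then have post: "mnorm A (post z) \<le> sqrt (1 - \<delta>) * mnorm A z"
    by (simp add: real_sqrt_mult mnorm_nonneg A)
  have "(mnorm A z)\<^sup>2 = pre w \<bullet> (A *v z)"
    using adj[of "pre w" z] by (simp add: mnorm_sq A Qz) (simp add: z_def)
  also have "\<dots> = w \<bullet> (A *v post z)"
    by (simp add: post_adjoint)
  also have "\<dots> \<le> mnorm A w * mnorm A (post z)"
    by (rule spd_Cauchy_Schwarz[OF A])
  also have "\<dots> \<le> mnorm A w * (sqrt (1 - \<delta>) * mnorm A z)"
    by (intro mult_left_mono post mnorm_nonneg A)
  finally have *: "mnorm A z * mnorm A z \<le> (sqrt (1 - \<delta>) * mnorm A w) * mnorm A z"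
    by (simp add: power2_eq_square mult_ac)
  show ?thesis
  proof (cases "mnorm A z = 0")
    case True
    then show ?thesis
      using \<open>\<delta> \<le> 1\<close> by (simp add: z_def[symmetric] mnorm_nonneg A)
  next
    case False
    then have "0 < mnorm A z"
      using mnorm_nonneg[OF A, of z] by linarith
    with * show ?thesis
      by (simp add: z_def[symmetric])
  qed
qed

subsection \<open>The constant of the exact two-level method\<close>

text \<open>Let \<open>v = (I - \<Pi>\<^sub>A) S vs\<close>. As \<open>v\<close> is energy-orthogonal to the range of \<open>\<Pi>\<^sub>A\<close>, its squared energy is
  \<open>v\<^sup>T A S vs\<close>, whose square is at most \<^term>\<open>damping v\<close> times \<open>vs\<^sup>T M vs\<close>. Taking the infimum over \<open>vs\<close>
  bounds the quotient of energy and damping by the infimum for \<open>v\<close>, and so by \<open>K\<^sub>T\<^sub>L\<close>, once the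
  supremum is known to be finite. For that, choose \<open>vs\<close> linearly in \<open>v\<close>: two quadratic forms in \<open>v\<close>, one
  of them positive definite, have bounded quotient. The quotient of energy and damping is at least \<open>1\<close>,
  which gives the second claim.\<close>
lemma K_TL_bound:
  shows "\<And>x. 1 / K_TL A S P Ms * (mnorm A ((mat 1 - Proj) *v x))\<^sup>2 \<le> damping ((mat 1 - Proj) *v x)"
    and "1 / K_TL A S P Ms \<le> 1"
proof -
  let ?Q = "mat 1 - Proj"
  define V where "V = range (\<lambda>x. ?Q *v x) - {0}"
  define F where "F v = {vs. v = ?Q *v (S *v vs)}" for v
  define g where "g v vs = (vs \<bullet> (M *v vs)) / (v \<bullet> (A *v v))" for v vs
  define K where "K = K_TL A S P Ms"
  have K: "K = (SUP v\<in>V. INF vs\<in>F v. g v vs)"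
    by (simp add: K_def K_TL_def V_def F_def g_def)
  have Vpos: "0 < v \<bullet> (A *v v)" if "v \<in> V" for v
    using that spd_pos[OF A] by (auto simp: V_def)
  have F_ne: "F v \<noteq> {}" if "v \<in> V" for v
    using that coPi_smoother_onto by (auto simp: V_def F_def)
  have g_nonneg: "0 \<le> g v vs" for v vs
    by (simp add: g_def spd_nonneg A M)
  have inf_le: "(INF vs\<in>F v. g v vs) \<le> g v vs" if "vs \<in> F v" for v vs
    by (rule cINF_lower[OF _ that]) (use g_nonneg in \<open>auto intro!: bdd_belowI2\<close>)
  define L where "L vs = ?Q *v (S *v vs)" for vs
  have "linear L"
    unfolding L_def matrix_vector_mul_assoc by (rule matrix_vector_mul_linear)
  from real_vector.linear_exists_right_inverse_on[OF this subspace_UNIV]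
  obtain R where R: "linear R" "\<And>v. v \<in> range L \<Longrightarrow> L (R v) = v"
    by auto
  \<comment> \<open>The smallest generalized eigenvalue \<open>l\<close> of the negated form bounds the quotients by \<open>- l\<close>.\<close>
  define H where "H = - (transpose (matrix R) ** M ** matrix R)"
  have "transpose H = H"
  proof -
    have "transpose (- Y) = - transpose Y" for Y :: "real^'n^'n"
      by (simp add: transpose_def vec_eq_iff)
    then show ?thesis
      using M by (simp add: H_def spd_def matrix_transpose_mul matrix_mul_assoc)
  qed
  then obtain l where l: "\<And>x. l * (x \<bullet> (A *v x)) \<le> x \<bullet> (H *v x)"
    using smallest_generalized_eigenvalue[OF _ A] by metis
  have Hx: "x \<bullet> (H *v x) = - (R x \<bullet> (M *v R x))" for x
  proof -
    have "H *v x = - ((transpose (matrix R) ** M ** matrix R) *v x)"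
      by (simp add: H_def vec_eq_iff matrix_vector_mult_def sum_negf)
    then show ?thesis
      by (simp add: matrix_vector_mul_assoc[symmetric] inner_transpose_right matrix_works
          R(1) matrix_vector_mul(2)[OF R(1), THEN fun_cong])
  qed
  have bdd: "bdd_above ((\<lambda>v. INF vs\<in>F v. g v vs) ` V)"
  proof (rule bdd_aboveI2)
    fix v assume v: "v \<in> V"
    then have "R v \<in> F v"
      using R(2)[of v] F_ne[OF v] by (auto simp: F_def L_def)
    then have "(INF vs\<in>F v. g v vs) \<le> g v (R v)"
      by (rule inf_le)
    also have "\<dots> \<le> - l"
      using l[of v] Vpos[OF v] by (simp add: g_def Hx field_simps)
    finally show "(INF vs\<in>F v. g v vs) \<le> - l" .
  qed
  have key: "0 < damping v \<and> v \<bullet> (A *v v) / damping v \<le> K" if v: "v \<in> V" for v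
  proof -
    have sq: "(v \<bullet> (A *v v))\<^sup>2 \<le> damping v * (vs \<bullet> (M *v vs))" if "vs \<in> F v" for vs
    proof -
      have vs: "v = ?Q *v (S *v vs)"
        using that by (simp add: F_def)
      have "v \<bullet> (A *v v) = v \<bullet> (A *v (S *v vs))"
        by (metis vs coPi_self_adjoint coPi_idem)
      also have "\<dots> = (transpose S *v (A *v v)) \<bullet> vs"
        using spd_sym[OF A, of v "S *v vs"]
        by (simp add: inner_transpose_left inner_commute[of "A *v v"])
      finally show ?thesis
        using spd_dual_Cauchy_Schwarz[OF M, of "transpose S *v (A *v v)" vs]
        by (simp add: damping_def)
    qed
    have "damping v \<noteq> 0"
    proof
      assume "damping v = 0"
      moreover obtain vs where "vs \<in> F v"
        using F_ne[OF v] by auto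
      ultimately show False
        using sq[of vs] Vpos[OF v] by simp
    qed
    with damping_nonneg[of v] have dpos: "0 < damping v"
      by linarith
    have "v \<bullet> (A *v v) / damping v \<le> (INF vs\<in>F v. g v vs)"
    proof (rule cINF_greatest[OF F_ne[OF v]])
      fix vs assume "vs \<in> F v"
      from sq[OF this] show "v \<bullet> (A *v v) / damping v \<le> g v vs"
        using dpos Vpos[OF v] by (simp add: g_def field_simps power2_eq_square)
    qed
    also have "\<dots> \<le> K"
      unfolding K by (rule cSUP_upper[OF v bdd])
    finally show ?thesis
      using dpos by simp
  qed
  obtain x0 where "?Q *v x0 \<noteq> 0"
    using coPi_nonzero by blast
  then have v0: "?Q *v x0 \<in> V"
    by (simp add: V_def)
  have "1 \<le> (?Q *v x0) \<bullet> (A *v (?Q *v x0)) / damping (?Q *v x0)"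
    using damping_le[of "?Q *v x0"] key[OF v0] by (simp add: mnorm_sq A)
  then have "1 \<le> K"
    using key[OF v0] by linarith
  then show "1 / K_TL A S P Ms \<le> 1"
    by (simp add: K_def[symmetric])
  show "1 / K_TL A S P Ms * (mnorm A (?Q *v x))\<^sup>2 \<le> damping (?Q *v x)" for x
  proof (cases "?Q *v x = 0")
    case True
    then show ?thesis
      by (simp add: damping_nonneg mnorm_def)
  next
    case False
    then have "?Q *v x \<in> V"
      by (simp add: V_def)
    from key[OF this] have "0 < damping (?Q *v x)"
      and "(?Q *v x) \<bullet> (A *v (?Q *v x)) / damping (?Q *v x) \<le> K"
      by auto
    with \<open>1 \<le> K\<close> show ?thesis
      by (simp add: K_def[symmetric] mnorm_sq A field_simps)
  qed
qed

text \<open>On the range of \<open>P\<close>, the damping is the form of \<open>H = C\<^sup>T M\<^sup>-\<^sup>1 C\<close> with \<open>C = S\<^sup>T A P\<close>, which is positive definite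
  by the rank assumption, and the energy is the form of \<open>A\<^sub>c\<close>. Their smallest quotient \<open>l > 0\<close> satisfies
  \<open>H y = l A\<^sub>c y\<close> for some \<open>y \<noteq> 0\<close>. Put \<open>G = S M\<^sup>-\<^sup>1 S\<^sup>T A\<close>. The vector \<open>G P y\<close> (and not \<open>P y\<close>, as \<open>G\<close> need not map
  the range of \<open>P\<close> into itself) is an eigenvector of \<open>G \<Pi>\<^sub>A\<close> for \<open>l\<close>, because
  \<open>\<Pi>\<^sub>A G P y = P A\<^sub>c\<^sup>-\<^sup>1 H y = l P y\<close>. So \<open>\<mu>\<^sub>T\<^sub>L \<le> l\<close>.\<close>
lemma mu_TL_bound:
  assumes "rank (transpose S ** A ** P) = CARD('c)"
  shows "mu_TL A S P Ms * (mnorm A (P *v y))\<^sup>2 \<le> damping (P *v y)"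
proof -
  let ?C = "transpose S ** A ** P"
  let ?W = "matrix_inv M"
  define H where "H = transpose ?C ** ?W ** ?C"
  define X where "X = S ** ?W ** transpose S ** A ** Proj"
  have "spd H"
    unfolding H_def using assms
    by (intro spd_congruence spd_inverse M) (simp add: full_rank_injective)
  then have "transpose H = H"
    by (simp add: spd_def)
  then obtain l y0 where y0: "y0 \<noteq> 0" "H *v y0 = l *\<^sub>R (Ac *v y0)"
    and low: "\<And>x. l * (x \<bullet> (Ac *v x)) \<le> x \<bullet> (H *v x)"
    by (rule smallest_generalized_eigenvalue[OF _ Ac]) (rule that)
  have "0 < l * (y0 \<bullet> (Ac *v y0))"
    using spd_pos[OF \<open>spd H\<close> y0(1)] by (simp add: y0(2))
  then have "0 < l"
    using spd_pos[OF Ac y0(1)] by (simp add: zero_less_mult_iff)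
  define v where "v = S *v (?W *v (transpose S *v (A *v (P *v y0))))"
  have At: "transpose A = A"
    using A by (simp add: spd_def)
  have PAv: "transpose P *v (A *v v) = H *v y0"
    by (simp add: H_def v_def matrix_transpose_mul At matrix_vector_mul_assoc[symmetric])
  have "v \<noteq> 0"
    using PAv spd_pos[OF \<open>spd H\<close> y0(1)] by auto
  moreover have "X *v v = l *\<^sub>R v"
  proof -
    have "Proj *v v = P *v (l *\<^sub>R y0)"
      by (simp add: Pi_mult PAv y0(2) matrix_vector_mult_scaleR
          matrix_inv_cancel spd_invertible[OF Ac])
    then have "X *v v = S *v (?W *v (transpose S *v (A *v (P *v (l *\<^sub>R y0)))))"
      by (simp add: X_def matrix_vector_mul_assoc[symmetric])
    then show ?thesis
      by (simp add: v_def matrix_vector_mult_scaleR)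
  qed
  ultimately have "eigenvalue X l"
    by (auto simp: eigenvalue_def)
  then have "mu_TL A S P Ms \<le> l"
    unfolding mu_TL_def lambda_min_pos_def X_def[symmetric] using \<open>0 < l\<close>
    by (intro Min_le finite_subset[OF _ finite_eigenvalues[of X]]) auto
  then have "mu_TL A S P Ms * (mnorm A (P *v y))\<^sup>2 \<le> l * (mnorm A (P *v y))\<^sup>2"
    by (intro mult_right_mono) auto
  also have "\<dots> \<le> y \<bullet> (H *v y)"
    using low[of y] by (simp add: mnorm_prolong mnorm_sq Ac)
  also have "\<dots> = damping (P *v y)"
    by (simp add: H_def damping_def matrix_vector_mul_assoc[symmetric] inner_transpose_right)
  finally show ?thesis .
qed

lemma mu_TL_le_1:
  assumes "rank (transpose S ** A ** P) = CARD('c)"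
  shows "mu_TL A S P Ms \<le> 1"
proof -
  have "axis undefined 1 \<noteq> (0 :: real^'c)"
    by simp
  then obtain y :: "real^'c" where "y \<noteq> 0"
    by blast
  then have "P *v y \<noteq> 0"
    using inj_P by (metis injD matrix_vector_mult_0_right)
  then have "0 < (mnorm A (P *v y))\<^sup>2"
    using mnorm_eq_0[OF A] by simp
  moreover have "mu_TL A S P Ms * (mnorm A (P *v y))\<^sup>2 \<le> 1 * (mnorm A (P *v y))\<^sup>2"
    using mu_TL_bound[OF assms, of y] damping_le[of "P *v y"] by simp
  ultimately show ?thesis
    by (simp only: mult_le_cancel_right_pos)
qed

subsection \<open>The inexact coarse solver\<close>
lemma coarse_residual_eq:
  "coarse_residual A f S P Ms B u0 k
    = coarse_rhs A f S P Ms u0 - Ac *v coarse_iter Ac B (coarse_rhs A f S P Ms u0) k"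
proof (induction k)
  case (Suc k)
  then show ?case
    by (simp add: coarse_residual_def Phi_def matrix_vector_right_distrib)
qed (simp add: coarse_residual_def)

lemma mnorm_inverse: "mnorm (matrix_inv Ac) r = mnorm Ac (matrix_inv Ac *v r)"
  by (simp add: mnorm_def matrix_inv_cancel spd_invertible[OF Ac] inner_commute)

text \<open>\<open>A\<^sub>c\<^sup>-\<^sup>1 r\<^sub>k\<close> is the error of the coarse iterate, and one step turns it into \<open>A\<^sub>c\<^sup>-\<^sup>1 r\<^sub>k - B\<^sub>k\<^sub>+\<^sub>1 r\<^sub>k\<close>, the
  vector in the accuracy assumption.\<close>
lemma coarse_error_decay:
  assumes "\<And>k. k \<in> {1..\<nu>} \<Longrightarrow> 0 \<le> \<epsilon> k"
    and "\<And>k. k \<in> {1..\<nu>} \<Longrightarrow>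
           mnorm Ac (matrix_inv Ac *v coarse_residual A f S P Ms B u0 (k - 1)
               - B k (coarse_residual A f S P Ms B u0 (k - 1)))
           \<le> \<epsilon> k * mnorm (matrix_inv Ac) (coarse_residual A f S P Ms B u0 (k - 1))"
  shows "mnorm Ac (matrix_inv Ac *v coarse_residual A f S P Ms B u0 \<nu>)
    \<le> (\<Prod>k=1..\<nu>. \<epsilon> k) * mnorm Ac (matrix_inv Ac *v coarse_rhs A f S P Ms u0)"
  using assms
proof (induction \<nu>)
  case 0
  then show ?case
    by (simp add: coarse_residual_def)
next
  case (Suc n)
  let ?r = "coarse_residual A f S P Ms B u0"
  have "?r (Suc n) = ?r n - Ac *v B (Suc n) (?r n)"
    by (simp add: coarse_residual_def Phi_def)
  then have "mnorm Ac (matrix_inv Ac *v ?r (Suc n))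
      = mnorm Ac (matrix_inv Ac *v ?r n - B (Suc n) (?r n))"
    by (simp add: matrix_vector_mult_diff_distrib matrix_inv_cancel spd_invertible[OF Ac])
  also have "\<dots> \<le> \<epsilon> (Suc n) * mnorm Ac (matrix_inv Ac *v ?r n)"
    using Suc.prems(2)[of "Suc n"] by (simp add: mnorm_inverse)
  also have "\<dots> \<le> \<epsilon> (Suc n) *
      ((\<Prod>k=1..n. \<epsilon> k) * mnorm Ac (matrix_inv Ac *v coarse_rhs A f S P Ms u0))"
    using Suc.prems by (intro mult_left_mono Suc.IH) auto
  finally show ?case
    by (simp add: mult_ac)
qed

subsection \<open>The error of one cycle\<close>

text \<open>The factor \<open>\<delta>\<close> stands for \<open>\<mu>\<^sub>T\<^sub>L\<close> or, in the rank-deficient case, for \<open>0\<close>. Estimating the pairing of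
  the new error \<open>w\<close> with itself, instead of its parts separately, makes each of the norms of
  \<open>(I - \<Pi>\<^sub>A) T\<close> and \<open>\<Pi>\<^sub>A T\<close> occur twice, so that their squares enter the bound.\<close>
lemma inexact_cycle_bound:
  assumes "mnorm A (P *v y) \<le> \<epsilon> * mnorm A (Proj *v pre e)" and "0 \<le> \<epsilon>" and "\<delta> \<le> 1"
    and "\<And>x. \<delta> * (mnorm A (Proj *v x))\<^sup>2 \<le> damping (Proj *v x)"
  shows "mnorm A (post ((mat 1 - Proj) *v pre e + P *v y))
    \<le> (1 - 1 / K_TL A S P Ms + \<epsilon> * (1 - \<delta>)) * mnorm A e"
proof -
  let ?Q = "mat 1 - Proj"
  define K where "K = K_TL A S P Ms"
  define w where "w = post (?Q *v pre e + P *v y)"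
  have K1: "1 / K \<le> 1"
    using K_TL_bound(2) by (simp add: K_def)
  have fine: "mnorm A (?Q *v pre x) \<le> sqrt (1 - 1 / K) * mnorm A x" for x
    unfolding K_def
    by (rule projected_pre_bound[OF coPi_self_adjoint coPi_idem K_TL_bound(1) K_TL_bound(2)])
  have coarse: "mnorm A (Proj *v pre x) \<le> sqrt (1 - \<delta>) * mnorm A x" for x
    by (rule projected_pre_bound[OF Pi_self_adjoint Pi_idem assms(4,3)])
  have "(mnorm A w)\<^sup>2 = pre w \<bullet> (A *v (?Q *v pre e + P *v y))"
    using post_adjoint[of w] by (simp add: mnorm_sq A w_def)
  also have "\<dots> = (?Q *v pre w) \<bullet> (A *v (?Q *v pre e)) + (Proj *v pre w) \<bullet> (A *v (P *v y))"
    using coPi_self_adjoint[of "pre w" "?Q *v pre e"] Pi_self_adjoint[of "pre w" "P *v y"]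
    by (simp add: matrix_vector_right_distrib inner_add_right coPi_idem Pi_prolong)
  also have "\<dots> \<le> mnorm A (?Q *v pre w) * mnorm A (?Q *v pre e)
      + mnorm A (Proj *v pre w) * mnorm A (P *v y)"
    by (intro add_mono spd_Cauchy_Schwarz A)
  also have "\<dots> \<le> (sqrt (1 - 1 / K) * mnorm A w) * (sqrt (1 - 1 / K) * mnorm A e)
      + (sqrt (1 - \<delta>) * mnorm A w) * (\<epsilon> * (sqrt (1 - \<delta>) * mnorm A e))"
  proof (intro add_mono mult_mono fine coarse)
    show "mnorm A (P *v y) \<le> \<epsilon> * (sqrt (1 - \<delta>) * mnorm A e)"
      using assms(1) mult_left_mono[OF coarse[of e] \<open>0 \<le> \<epsilon>\<close>] by linarith
  qed (use K1 \<open>\<delta> \<le> 1\<close> in \<open>auto simp: mnorm_nonneg A\<close>)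
  also have "\<dots> = ((sqrt (1 - 1 / K))\<^sup>2 + \<epsilon> * (sqrt (1 - \<delta>))\<^sup>2) * mnorm A e * mnorm A w"
    by (simp only: power2_eq_square) (simp add: algebra_simps)
  also have "\<dots> = ((1 - 1 / K) + \<epsilon> * (1 - \<delta>)) * mnorm A e * mnorm A w"
    using K1 \<open>\<delta> \<le> 1\<close> by simp
  finally have *: "mnorm A w * mnorm A w
      \<le> ((1 - 1 / K) + \<epsilon> * (1 - \<delta>)) * mnorm A e * mnorm A w"
    by (simp add: power2_eq_square)
  have "mnorm A w \<le> ((1 - 1 / K) + \<epsilon> * (1 - \<delta>)) * mnorm A e"
  proof (cases "mnorm A w = 0")
    case True
    then show ?thesis
      using K1 \<open>\<delta> \<le> 1\<close> \<open>0 \<le> \<epsilon>\<close> by (simp add: mnorm_nonneg A)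
  next
    case False
    then have "0 < mnorm A w"
      using mnorm_nonneg[OF A, of w] by linarith
    with * show ?thesis
      by simp
  qed
  then show ?thesis
    by (simp add: w_def K_def)
qed

text \<open>By the second identity, solving the coarse problem exactly corrects by \<open>\<Pi>\<^sub>A T e\<close>; the part missing
  from that correction is the prolongated coarse error.\<close>
lemma u_ITL_error:
  assumes "u = matrix_inv A *v f"
  shows "u - u_ITL A f S P Ms B \<nu> u0
    = post ((mat 1 - Proj) *v pre (u - u0)
        + P *v (matrix_inv Ac *v coarse_residual A f S P Ms B u0 \<nu>))"
    and "P *v (matrix_inv Ac *v coarse_rhs A f S P Ms u0) = Proj *v pre (u - u0)"
proof -
  have f: "f = A *v u"
    by (simp add: assms matrix_inv_cancel spd_invertible[OF A])
  define e1 where "e1 = pre (u - u0)"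
  have u1: "u - presmooth A f S Ms u0 = e1"
    by (simp add: presmooth_def e1_def pre_def f matrix_vector_mult_diff_distrib)
  define rc where "rc = coarse_rhs A f S P Ms u0"
  have rc: "rc = transpose P *v (A *v e1)"
    by (simp add: rc_def coarse_rhs_def f u1[symmetric] matrix_vector_mult_diff_distrib)
  show Pi: "P *v (matrix_inv Ac *v coarse_rhs A f S P Ms u0) = Proj *v pre (u - u0)"
    by (simp add: Pi_mult rc_def[symmetric] e1_def[symmetric] rc)
  define ec where "ec = coarse_iter Ac B rc \<nu>"
  define u2 where "u2 = presmooth A f S Ms u0 + P *v ec"
  have "matrix_inv Ac *v coarse_residual A f S P Ms B u0 \<nu> = matrix_inv Ac *v rc - ec"
    by (simp add: coarse_residual_eq rc_def[symmetric] ec_def[symmetric]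
        matrix_vector_mult_diff_distrib matrix_inv_cancel spd_invertible[OF Ac])
  then have "(mat 1 - Proj) *v pre (u - u0)
        + P *v (matrix_inv Ac *v coarse_residual A f S P Ms B u0 \<nu>) = e1 - P *v ec"
    using Pi by (simp add: coPi_mult matrix_vector_mult_diff_distrib rc_def[symmetric] e1_def)
  also have "\<dots> = u - u2"
    by (simp add: u2_def u1[symmetric])
  finally have u2: "(mat 1 - Proj) *v pre (u - u0)
        + P *v (matrix_inv Ac *v coarse_residual A f S P Ms B u0 \<nu>) = u - u2" .
  have "u_ITL A f S P Ms B \<nu> u0
      = u2 + S *v (matrix_inv (transpose Ms) *v (transpose S *v (f - A *v u2)))"
    by (simp add: u_ITL_def Let_def rc_def ec_def u2_def)
  then show "u - u_ITL A f S P Ms B \<nu> u0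
    = post ((mat 1 - Proj) *v pre (u - u0)
        + P *v (matrix_inv Ac *v coarse_residual A f S P Ms B u0 \<nu>))"
    unfolding u2 by (simp add: post_def f matrix_vector_mult_diff_distrib)
qed

end

section \<open>The convergence estimate\<close>

theorem theorem3p5:
  fixes A :: "real^'n^'n"
    and f u u0 :: "real^'n"
    and S :: "real^'s^'n"
    and P :: "real^'c^'n"
    and Ms :: "real^'s^'s"
    and B :: "nat \<Rightarrow> real^'c \<Rightarrow> real^'c"
    and \<nu> :: nat
    and \<epsilon> :: "nat \<Rightarrow> real"
  assumes "spd A"
    and "u = matrix_inv A *v f"
    and "rank S = CARD('s)"
    and "rank P = CARD('c)"
    and "rank (hblock S P) = CARD('n)"
    and "max CARD('s) CARD('c) < CARD('n)"
    and "CARD('n) \<le> CARD('s) + CARD('c)"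
    and "invertible Ms"
    and "spd (Ms + transpose Ms - galerkin A S)"
    and "\<nu> \<ge> 1"
    and "\<And>k. k \<in> {1..\<nu>} \<Longrightarrow> 0 \<le> \<epsilon> k \<and> \<epsilon> k < 1"
    and "\<And>k. k \<in> {1..\<nu>} \<Longrightarrow>
           mnorm (galerkin A P)
             (matrix_inv (galerkin A P) *v coarse_residual A f S P Ms B u0 (k - 1)
               - B k (coarse_residual A f S P Ms B u0 (k - 1)))
           \<le> \<epsilon> k * mnorm (matrix_inv (galerkin A P)) (coarse_residual A f S P Ms B u0 (k - 1))"
  shows "mnorm A (u - u_ITL A f S P Ms B \<nu> u0)
           \<le> sigma_ITL A S P Ms (\<Prod>k=1..\<nu>. \<epsilon> k) * mnorm A (u - u0)"
proof -
  interpret two_level A S P Ms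
    using assms(1,4,5,6,8,9)
    by unfold_locales (auto simp: full_rank_injective full_rank_surjective)
  define \<delta> where
    "\<delta> = (if rank (transpose S ** A ** P) = CARD('c) then mu_TL A S P Ms else 0)"
  have "\<delta> \<le> 1"
    by (simp add: \<delta>_def mu_TL_le_1)
  have damp: "\<delta> * (mnorm A (Proj *v x))\<^sup>2 \<le> damping (Proj *v x)" for x
    by (simp add: \<delta>_def Pi_mult mu_TL_bound damping_nonneg)
  have sigma: "sigma_ITL A S P Ms e = 1 - 1 / K_TL A S P Ms + e * (1 - \<delta>)" for e
    by (simp add: sigma_ITL_def \<delta>_def)
  have "mnorm A (P *v (matrix_inv Ac *v coarse_residual A f S P Ms B u0 \<nu>))
      \<le> (\<Prod>k=1..\<nu>. \<epsilon> k) * mnorm A (Proj *v pre (u - u0))"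
    using coarse_error_decay[of \<nu> \<epsilon> f B u0] assms(11,12)
    by (simp add: mnorm_prolong u_ITL_error(2)[OF assms(2), symmetric])
  moreover have "0 \<le> (\<Prod>k=1..\<nu>. \<epsilon> k)"
    using assms(11) by (intro prod_nonneg) auto
  ultimately show ?thesis
    unfolding u_ITL_error(1)[OF assms(2)] sigma
    using \<open>\<delta> \<le> 1\<close> damp by (rule inexact_cycle_bound)
qed

end
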